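(* Let two palindromes occurring in a word $w$ intersect (that is, share at least one position). If neither is a proper factor of the other and at least one of the two does not contain the centre of the other, then their union is a palindromic periodicity whose half-period equals the distance between the palindromes' centres.
   Context: Words are finite sequences of letters $w=w[1]w[2]\cdots w[n]$, $|w|=n$, and $w[i\dots j]$ denotes the factor occupying positions $i$ to $j$. A word is a palindrome if it equals its reverse; the empty word is a palindrome. If $w[i\dots j]$ is a palindrome, its centre is $(i+j)/2$. Palindromes in $w$ are considered as occurrences, i.e. together with their positions. Convention for containing a centre: an integer position $x$ is in $w[a\dots b]$ if $a\le x\le b$; for half-integer positions, $a-1/2$ is regarded as being in $w[a\dots b]$ but $b+1/2$ is not. Thus $w[a\dots b]$ contains the centre $c$ if and only if $a-1/2\le c\le b$. An occurrence $w[c\dots d]$ is a proper factor of $w[a\dots b]$ if it lies inside it and is neither a prefix nor a suffix of it, i.e. $a<c\le d<b$. The union of two intersecting occurrences is the factor of $w$ occupying all positions covered by at least one of them. For a nonempty word $x$, $x^\omega=xxx\cdots$. A word $v$ is a palindromic periodicity with half-period $h$ (where $2h\ge 1$ is an integer) if there are palindromes $p$ and $s$ (either of which may be empty) with $|ps|=2h$ such that $v$ is a factor of $(ps)^\omega$ and $|v|\ge 2h$. *)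

theory Defs
  imports Complex_Main "HOL-Library.Omega_Words_Fun"
begin

text \<open>
  Positions in a word are counted from 1. An occurrence of a factor of \<open>w\<close> is given by its first
  and last positions \<open>a\<close> and \<open>b\<close>; the empty occurrences are those with \<open>a = b + 1\<close>.
\<close>

definition factor :: "'a list \<Rightarrow> nat \<Rightarrow> nat \<Rightarrow> 'a list" where
  "factor w i j = take (Suc j - i) (drop (i - 1) w)"

definition occurrence :: "'a list \<Rightarrow> nat \<Rightarrow> nat \<Rightarrow> bool" where
  "occurrence w a b \<longleftrightarrow> 1 \<le> a \<and> a \<le> Suc b \<and> b \<le> length w"

definition palindrome :: "'a list \<Rightarrow> bool" where
  "palindrome u \<longleftrightarrow> rev u = u"

definition palindrome_occurrence :: "'a list \<Rightarrow> nat \<Rightarrow> nat \<Rightarrow> bool" where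
  "palindrome_occurrence w a b \<longleftrightarrow> occurrence w a b \<and> palindrome (factor w a b)"

definition centre :: "nat \<Rightarrow> nat \<Rightarrow> real" where
  "centre i j = (real i + real j) / 2"

text \<open>
  The bounds are deliberately asymmetric: the half-integer position just before an occurrence
  belongs to it, the one just after it does not.
\<close>

definition contains_position :: "nat \<Rightarrow> nat \<Rightarrow> real \<Rightarrow> bool" where
  "contains_position a b x \<longleftrightarrow> real a - 1 / 2 \<le> x \<and> x \<le> real b"

definition intersecting :: "nat \<Rightarrow> nat \<Rightarrow> nat \<Rightarrow> nat \<Rightarrow> bool" where
  "intersecting a b c d \<longleftrightarrow> {a..b} \<inter> {c..d} \<noteq> {}"

definition proper_factor :: "nat \<Rightarrow> nat \<Rightarrow> nat \<Rightarrow> nat \<Rightarrow> bool" where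
  "proper_factor c d a b \<longleftrightarrow> a < c \<and> c \<le> d \<and> d < b"

text \<open>Only meaningful for intersecting occurrences, as \<open>intersecting_Un\<close> shows.\<close>

definition union_factor :: "'a list \<Rightarrow> nat \<Rightarrow> nat \<Rightarrow> nat \<Rightarrow> nat \<Rightarrow> 'a list" where
  "union_factor w a b c d = factor w (min a c) (max b d)"

lemma intersecting_Un:
  assumes "intersecting a b c d"
  shows "{a..b} \<union> {c..d} = {min a c..max b d}"
  using assms by (auto simp: intersecting_def)

definition factor_of_omega_word :: "'a list \<Rightarrow> 'a word \<Rightarrow> bool" where
  "factor_of_omega_word v x \<longleftrightarrow> (\<exists>i j. i \<le> j \<and> v = x [i \<rightarrow> j])"

definition palindromic_periodicity :: "'a list \<Rightarrow> real \<Rightarrow> bool" where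
  "palindromic_periodicity v h \<longleftrightarrow>
     2 * h \<in> \<int> \<and> 2 * h \<ge> 1 \<and>
     (\<exists>p s. palindrome p \<and> palindrome s \<and> real (length (p @ s)) = 2 * h \<and>
            factor_of_omega_word v ((p @ s)\<^sup>\<omega>) \<and> real (length v) \<ge> 2 * h)"

end

theory Submission
  imports Defs
begin

text \<open>
  Neither occurrence being a proper factor of the other, one of them starts and ends no later than
  the other, so the union is a word \<open>v\<close> of length \<open>n\<close> covered by a palindromic prefix of length
  \<open>L\<close> and a palindromic suffix of length \<open>M\<close>, and the statement becomes one about \<open>v\<close> alone.
  The distance between the two centres is half of \<open>q = (n - L) + (n - M)\<close>. Reflecting a position
  of \<open>v\<close> in the centre of the prefix and then in the centre of the suffix translates it by \<open>q\<close>, and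
  whenever a position and its translate both lie in \<open>v\<close>, the intermediate position lies in both
  palindromes. Hence \<open>v\<close> has period \<open>q\<close> (\<open>period_of_palindromic_prefix_and_suffix\<close>).

  Since \<open>v\<close> is covered by the two palindromes, \<open>n \<le> L + M\<close>, which is the same as \<open>q \<le> n\<close>; so
  \<open>v\<close> is a prefix of the infinite repetition of its first \<open>q\<close> letters. These split as \<open>p @ s\<close> with
  \<open>length p = L mod q\<close>: modulo \<open>q\<close>, the reflections of \<open>p\<close> and of \<open>s\<close> onto themselves are both the
  reflection in the centre of the prefix, so both are palindromes
  (\<open>palindromic_periodicity_of_palindromic_prefix_and_suffix\<close>). The hypothesis about centres enters
  by making the two centres distinct, that is, \<open>q > 0\<close>.
\<close>

lemma palindromeI_nth:
  assumes "\<And>i. i < length u \<Longrightarrow> u ! i = u ! (length u - 1 - i)"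
  shows "palindrome u"
  unfolding palindrome_def
proof (rule nth_equalityI)
  fix i assume "i < length (rev u)"
  then show "rev u ! i = u ! i"
    using assms[of i] by (simp add: rev_nth)
qed simp

lemma palindrome_nth:
  assumes "palindrome u" "i < length u"
  shows "u ! i = u ! (length u - 1 - i)"
  using assms rev_nth[of i u] by (simp add: palindrome_def)

lemma palindromic_prefix_nth:
  assumes "palindrome (take L v)" "L \<le> length v" "i < L"
  shows "v ! i = v ! (L - 1 - i)"
  using palindrome_nth[OF assms(1), of i] assms(2,3) by simp

lemma palindromic_suffix_nth:
  assumes "palindrome (drop k v)" "k \<le> i" "i < length v"
  shows "v ! i = v ! (k + length v - 1 - i)"
proof -
  have "drop k v ! (i - k) = drop k v ! (length v - k - 1 - (i - k))"
    using palindrome_nth[OF assms(1), of "i - k"] assms(2,3) by simp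
  moreover have "k + (length v - k - 1 - (i - k)) = k + length v - 1 - i"
    using assms(2,3) by simp
  ultimately show ?thesis
    using assms(2,3) by (simp add: nth_drop)
qed

text \<open>
  The composition of the two reflections is the translation by \<open>k + (length v - L)\<close>, and
  the bound on \<open>i\<close> says exactly that the reflected position \<open>L - 1 - i\<close> lies in the suffix.
\<close>

lemma period_of_palindromic_prefix_and_suffix:
  assumes pre: "palindrome (take L v)" and suf: "palindrome (drop k v)"
    and L: "L \<le> length v" and i: "i + (k + (length v - L)) < length v"
  shows "v ! i = v ! (i + (k + (length v - L)))"
proof -
  have "v ! i = v ! (L - 1 - i)"
    using palindromic_prefix_nth[OF pre L, of i] i L by simp
  also have "\<dots> = v ! (k + length v - 1 - (L - 1 - i))"
    using palindromic_suffix_nth[OF suf, of "L - 1 - i"] i L by simp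
  also have "k + length v - 1 - (L - 1 - i) = i + (k + (length v - L))"
    using i L by simp
  finally show ?thesis .
qed

lemma period_multiple:
  assumes "\<And>i. i + q < length v \<Longrightarrow> v ! i = v ! (i + q)" and "i + m * q < length v"
  shows "v ! (i + m * q) = v ! i"
  using assms(2)
proof (induction m)
  case (Suc m)
  then show ?case
    using assms(1)[of "i + m * q"] by (simp add: algebra_simps)
qed simp

text \<open>
  A split of one period into two palindromes is all that a periodic word needs in order to be a
  palindromic periodicity: the word is read off from the start of \<open>(p @ s)\<^sup>\<omega>\<close>.
\<close>

lemma palindromic_periodicityI:
  assumes period: "\<And>i. i + q < length v \<Longrightarrow> v ! i = v ! (i + q)"
    and q: "0 < q" "q \<le> length v" and r: "r \<le> q"
    and p: "palindrome (take r v)" and s: "palindrome (take (q - r) (drop r v))"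
  shows "palindromic_periodicity v (real q / 2)"
proof -
  let ?p = "take r v" and ?s = "take (q - r) (drop r v)"
  have ps: "?p @ ?s = take q v"
    using r by (metis le_add_diff_inverse take_add)
  have "v = ((?p @ ?s)\<^sup>\<omega>) [0 \<rightarrow> length v]"
  proof (rule nth_equalityI)
    fix i assume i: "i < length v"
    have "v ! (i mod q + i div q * q) = v ! (i mod q)"
      by (rule period_multiple[OF period]) (use i in auto)
    then show "v ! i = (((?p @ ?s)\<^sup>\<omega>) [0 \<rightarrow> length v]) ! i"
      using i q unfolding ps by (simp add: min_absorb2)
  qed simp
  then have "factor_of_omega_word v ((?p @ ?s)\<^sup>\<omega>)"
    unfolding factor_of_omega_word_def by blast
  moreover have "real (length (?p @ ?s)) = 2 * (real q / 2)"
    unfolding ps using q by simp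
  moreover have "2 * (real q / 2) \<in> \<int>" "2 * (real q / 2) \<ge> 1" "real (length v) \<ge> 2 * (real q / 2)"
    using q by simp_all
  ultimately show ?thesis
    unfolding palindromic_periodicity_def using p s by blast
qed

text \<open>
  The hypothesis \<open>k \<le> L\<close> says that the prefix and the suffix cover \<open>v\<close>. Cutting the first period at
  \<open>L mod q\<close> makes the reflection in the centre of the prefix agree, modulo \<open>q\<close>, with the
  reflections of both pieces.
\<close>

lemma palindromic_periodicity_of_palindromic_prefix_and_suffix:
  assumes pre: "palindrome (take L v)" and suf: "palindrome (drop k v)"
    and L: "L \<le> length v" and k: "k \<le> L"
    and q: "q = k + (length v - L)" "0 < q"
  shows "palindromic_periodicity v (real q / 2)"
proof (rule palindromic_periodicityI)
  show period: "v ! i = v ! (i + q)" if "i + q < length v" for i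
    using period_of_palindromic_prefix_and_suffix[OF pre suf L, of i] that q by simp
  show "0 < q" "q \<le> length v"
    using q L k by simp_all
  define r where "r = L mod q"
  define m where "m = L div q"
  have Lrm: "L = r + m * q"
    by (simp add: r_def m_def)
  have r: "r < q"
    using q by (simp add: r_def)
  have q_le: "q \<le> length v"
    by fact
  show "r \<le> q"
    using r by simp
  show "palindrome (take r v)"
  proof (rule palindromeI_nth)
    fix i assume "i < length (take r v)"
    then have i: "i < r"
      by simp
    have eq: "L - 1 - i = (r - 1 - i) + m * q"
      using i Lrm by simp
    have "v ! i = v ! ((r - 1 - i) + m * q)"
      using palindromic_prefix_nth[OF pre L, of i] i Lrm eq by simp
    also have "\<dots> = v ! (r - 1 - i)"
      by (rule period_multiple[OF period]) (use i L Lrm in auto)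
    finally show "take r v ! i = take r v ! (length (take r v) - 1 - i)"
      using i r q_le by simp
  qed
  have reflect: "v ! i = v ! (q + r - 1 - i)" if i: "r \<le> i" "i < q" for i
  proof (cases m)
    case 0
    \<comment> \<open>The second piece starts where the prefix ends, and lies entirely in the suffix.\<close>
    have "v ! i = v ! (k + length v - 1 - i)"
      using palindromic_suffix_nth[OF suf, of i] i k q_le 0 Lrm by simp
    also have "k + length v - 1 - i = q + r - 1 - i"
      using 0 Lrm q L by simp
    finally show ?thesis .
  next
    case (Suc m')
    have eq: "L - 1 - i = (q + r - 1 - i) + m' * q"
      using i Lrm Suc by simp
    have "v ! i = v ! ((q + r - 1 - i) + m' * q)"
      using palindromic_prefix_nth[OF pre L, of i] i Lrm Suc eq by simp
    also have "\<dots> = v ! (q + r - 1 - i)"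
      by (rule period_multiple[OF period]) (use i L Lrm Suc in auto)
    finally show ?thesis .
  qed
  show "palindrome (take (q - r) (drop r v))"
  proof (rule palindromeI_nth)
    fix i assume "i < length (take (q - r) (drop r v))"
    then have i: "i < q - r"
      by simp
    have len: "length (take (q - r) (drop r v)) = q - r"
      using q_le by simp
    have "v ! (r + i) = v ! (r + (q - r - 1 - i))"
      using reflect[of "r + i"] i by simp
    then show "take (q - r) (drop r v) ! i =
        take (q - r) (drop r v) ! (length (take (q - r) (drop r v)) - 1 - i)"
      using i q_le r unfolding len by simp
  qed
qed

lemma factor_prefix_of_factor:
  assumes "1 \<le> a" "b \<le> d"
  shows "factor w a b = take (Suc b - a) (factor w a d)"
  using assms by (simp add: factor_def min_def)

lemma factor_suffix_of_factor:
  assumes "1 \<le> a" "a \<le> c"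
  shows "factor w c d = drop (c - a) (factor w a d)"
  using assms by (simp add: factor_def drop_take)

text \<open>
  Neither occurrence being a proper factor of the other means, up to exchanging them, that
  both endpoints of the first weakly precede those of the second.
\<close>

lemma palindromic_periodicity_of_overlap:
  assumes ab: "palindrome_occurrence w a b" and cd: "palindrome_occurrence w c d"
    and "a \<le> c" "c \<le> b" "b \<le> d" "a + b < c + d"
  shows "palindromic_periodicity (factor w a d) (centre c d - centre a b)"
proof -
  let ?v = "factor w a d"
  have a1: "1 \<le> a" and d: "d \<le> length w"
    using ab cd by (auto simp: palindrome_occurrence_def occurrence_def)
  have len: "length ?v = Suc d - a"
    using a1 d by (simp add: factor_def)
  have "palindrome (take (Suc b - a) ?v)" "palindrome (drop (c - a) ?v)"
    using ab cd a1 assms(3,5) factor_prefix_of_factor[of a b d w] factor_suffix_of_factor[of a c w d]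
    by (simp_all add: palindrome_occurrence_def)
  then have "palindromic_periodicity ?v (real ((c - a) + (d - b)) / 2)"
    by (rule palindromic_periodicity_of_palindromic_prefix_and_suffix)
       (use assms len in auto)
  moreover have "real ((c - a) + (d - b)) / 2 = centre c d - centre a b"
    using assms by (simp add: centre_def of_nat_diff field_simps)
  ultimately show ?thesis
    by (simp only:)
qed

theorem theorem2p6:
  fixes w :: "'a list" and a b c d :: nat
  assumes "palindrome_occurrence w a b"
    and "palindrome_occurrence w c d"
    and "intersecting a b c d"
    and "\<not> proper_factor a b c d"
    and "\<not> proper_factor c d a b"
    and "\<not> contains_position a b (centre c d) \<or> \<not> contains_position c d (centre a b)"
  shows "palindromic_periodicity (union_factor w a b c d) \<bar>centre a b - centre c d\<bar>"
proof -
  have ineqs: "a \<le> b" "c \<le> d" "a \<le> d" "c \<le> b"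
    using assms(3) by (auto simp: intersecting_def)
  \<comment> \<open>A nonempty occurrence contains its own centre, so a common centre would lie in both.\<close>
  have "centre a b \<noteq> centre c d"
    using assms(6) ineqs by (auto simp: contains_position_def centre_def field_simps)
  then have ne: "a + b \<noteq> c + d"
    by (auto simp: centre_def simp flip: of_nat_add)
  consider "a \<le> c" "b \<le> d" | "c \<le> a" "d \<le> b"
    using assms(4,5) ineqs by (force simp: proper_factor_def)
  then show ?thesis
  proof cases
    case 1
    then have "a + b < c + d"
      using ne by simp
    then have "centre a b \<le> centre c d"
      by (simp add: centre_def divide_right_mono flip: of_nat_add)
    then show ?thesis
      using palindromic_periodicity_of_overlap[OF assms(1,2)] 1 ineqs \<open>a + b < c + d\<close>
      by (simp add: union_factor_def min_absorb1 max_absorb2 abs_minus_commute)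
  next
    case 2
    then have "c + d < a + b"
      using ne by simp
    then have "centre c d \<le> centre a b"
      by (simp add: centre_def divide_right_mono flip: of_nat_add)
    then show ?thesis
      using palindromic_periodicity_of_overlap[OF assms(2,1)] 2 ineqs \<open>c + d < a + b\<close>
      by (simp add: union_factor_def min_absorb2 max_absorb1)
  qed
qed

end
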